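(* Let $G$ be a connected graph with at least $2$ vertices, let $H$ be a connected graph, and let $U$ be a non-empty subset of $V(G)$. Then \[F(G(U)\Pi H)=|V(H)|\,F(G)+6|E(H)|\sum_{u\in U}d_G(u)^2+3M_1(H)\sum_{u\in U}d_G(u)+|U|\,F(H).\]
   Context: All graphs are finite, simple and undirected; $d_G(v)$ is the degree of $v$ in $G$. The F-index is $F(G)=\sum_{v\in V(G)}d_G(v)^3$ and the first Zagreb index is $M_1(G)=\sum_{v\in V(G)}d_G(v)^2$. For graphs $G,H$ and a non-empty $U\subseteq V(G)$, the generalized hierarchical product $G(U)\Pi H$ is the graph with vertex set $V(G)\times V(H)$ in which $(u,v)$ and $(u',v')$ are adjacent if and only if either [$u=u'\in U$ and $vv'\in E(H)$] or [$v=v'$ and $uu'\in E(G)$]. *)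

theory Defs
  imports Main
begin

record 'a ugraph =
  verts :: "'a set"
  edges :: "'a set set"

definition simple_graph :: "'a ugraph \<Rightarrow> bool" where
  "simple_graph G \<longleftrightarrow> finite (verts G) \<and> (\<forall>e\<in>edges G. e \<subseteq> verts G \<and> card e = 2)"

definition adjacent :: "'a ugraph \<Rightarrow> 'a \<Rightarrow> 'a \<Rightarrow> bool" where
  "adjacent G u v \<longleftrightarrow> {u, v} \<in> edges G"

(* The graph with no vertices satisfies this vacuously. *)
definition connected_graph :: "'a ugraph \<Rightarrow> bool" where
  "connected_graph G \<longleftrightarrow>
     simple_graph G \<and> (\<forall>u\<in>verts G. \<forall>v\<in>verts G. (adjacent G)\<^sup>*\<^sup>* u v)"

definition degree :: "'a ugraph \<Rightarrow> 'a \<Rightarrow> nat" where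
  "degree G v = card {e \<in> edges G. v \<in> e}"

definition F_index :: "'a ugraph \<Rightarrow> nat" where
  "F_index G = (\<Sum>v\<in>verts G. degree G v ^ 3)"

definition first_Zagreb :: "'a ugraph \<Rightarrow> nat" where
  "first_Zagreb G = (\<Sum>v\<in>verts G. degree G v ^ 2)"

definition hier_prod :: "'a ugraph \<Rightarrow> 'a set \<Rightarrow> 'b ugraph \<Rightarrow> ('a \<times> 'b) ugraph" where
  "hier_prod G U H =
     \<lparr> verts = verts G \<times> verts H,
       edges = {{(u, v), (u', v')} | u v u' v'.
          (u, v) \<in> verts G \<times> verts H \<and> (u', v') \<in> verts G \<times> verts H \<and>
          ((u = u' \<and> u \<in> U \<and> adjacent H v v') \<or> (v = v' \<and> adjacent G u u'))} \<rparr>"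

lemma adjacent_hier_prod_iff:
  assumes "(u, v) \<in> verts G \<times> verts H" and "(u', v') \<in> verts G \<times> verts H"
  shows "adjacent (hier_prod G U H) (u, v) (u', v') \<longleftrightarrow>
    (u = u' \<and> u \<in> U \<and> adjacent H v v') \<or> (v = v' \<and> adjacent G u u')"
  using assms
  by (auto simp: adjacent_def hier_prod_def doubleton_eq_iff insert_commute)

lemma simple_graph_hier_prod:
  assumes "simple_graph G" and "simple_graph H"
  shows "simple_graph (hier_prod G U H)"
proof -
  have irrefl: "\<not> adjacent G x x" "\<not> adjacent H y y" for x y
    using assms by (auto simp: simple_graph_def adjacent_def)
  have "finite (verts G \<times> verts H)"
    using assms by (simp add: simple_graph_def)
  then show ?thesis
    using irrefl by (auto simp: simple_graph_def hier_prod_def card_insert_if)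
qed

end

theory Submission
  imports Defs
begin

text \<open>In the product, \<open>(u, v)\<close> has degree d_G(u), increased by d_H(v) exactly
  when u lies in U (\<open>degree_hier_prod\<close>). Cube this and sum over the fibre of all
  \<open>(u, v)\<close> with u fixed. If u is outside U, only |V(H)| d_G(u)^3 appears. If u is in U,
  the binomial expansion adds 3 d_G(u)^2 times the degree sum of H, 3 d_G(u) M_1(H) and F(H); the
  degree sum is 2|E(H)| by \<open>sum_degree_eq_twice_card_edges\<close>. Summing over u gives the
  formula.\<close>

text \<open>The map sending w to \<open>{v, w}\<close> is a bijection from the neighbours of v to
  the edges at v. This lets degrees in the product be read off from its adjacency relation.\<close>

lemma degree_eq_card_neighbours:
  assumes "simple_graph G"
  shows "degree G v = card {w. adjacent G v w}"
proof -
  have "bij_betw (\<lambda>w. {v, w}) {w. adjacent G v w} {e \<in> edges G. v \<in> e}"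
  proof (rule bij_betw_imageI)
    show "inj_on (\<lambda>w. {v, w}) {w. adjacent G v w}"
      by (auto simp: inj_on_def doubleton_eq_iff)
    have "\<exists>w. e = {v, w}" if "e \<in> edges G" "v \<in> e" for e
    proof -
      have "card e = 2" using assms that by (auto simp: simple_graph_def)
      then show ?thesis using that by (auto simp: card_2_iff)
    qed
    then show "(\<lambda>w. {v, w}) ` {w. adjacent G v w} = {e \<in> edges G. v \<in> e}"
      by (fastforce simp: adjacent_def)
  qed
  then show ?thesis
    by (simp add: degree_def bij_betw_same_card)
qed

lemma adjacent_in_verts:
  assumes "simple_graph G" "adjacent G v w"
  shows "v \<in> verts G" "w \<in> verts G"
  using assms by (auto simp: simple_graph_def adjacent_def)

lemma finite_neighbours:
  assumes "simple_graph G"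
  shows "finite {w. adjacent G v w}"
proof (rule finite_subset)
  show "{w. adjacent G v w} \<subseteq> verts G"
    using adjacent_in_verts[OF assms] by blast
  show "finite (verts G)" using assms by (simp add: simple_graph_def)
qed

text \<open>Handshake lemma: count incident vertex-edge pairs in two ways, each edge containing
  exactly two vertices.\<close>

lemma sum_degree_eq_twice_card_edges:
  assumes "simple_graph G"
  shows "(\<Sum>v\<in>verts G. degree G v) = 2 * card (edges G)"
proof -
  have fin: "finite (verts G)" using assms by (simp add: simple_graph_def)
  have "edges G \<subseteq> Pow (verts G)" using assms by (auto simp: simple_graph_def)
  then have "finite (edges G)" using fin finite_subset by blast
  moreover have "card {v \<in> verts G. v \<in> e} = 2" if "e \<in> edges G" for e
  proof -
    have "e \<subseteq> verts G" "card e = 2" using assms that by (auto simp: simple_graph_def)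
    then show ?thesis by (metis Collect_mem_eq Collect_conj_eq Int_absorb1)
  qed
  ultimately show ?thesis
    using sum_multicount[of "verts G" "edges G" "\<lambda>v e. v \<in> e" 2] fin
    by (simp add: degree_def)
qed

text \<open>The neighbours of \<open>(u, v)\<close> are a copy \<open>?N\<close> of the G-neighbours
  of u and, for u in U, a copy \<open>?M\<close> of the H-neighbours of v. A common element would
  have first coordinate u, making u adjacent to itself in G, so the two sizes add up.\<close>

lemma degree_hier_prod:
  assumes G: "simple_graph G" and H: "simple_graph H"
    and "u \<in> verts G" "v \<in> verts H"
  shows "degree (hier_prod G U H) (u, v) = degree G u + (if u \<in> U then degree H v else 0)"
proof -
  let ?N = "{w. adjacent G u w} \<times> {v}"
  let ?M = "if u \<in> U then {u} \<times> {w. adjacent H v w} else {}"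
  note prod = simple_graph_hier_prod[OF G H, of U]
  have irrefl: "\<not> adjacent G u u"
    using G by (auto simp: simple_graph_def adjacent_def)
  have "adjacent (hier_prod G U H) (u, v) (x, y) \<longleftrightarrow> (x, y) \<in> ?N \<union> ?M" for x y
  proof (cases "(x, y) \<in> verts G \<times> verts H")
    case True
    then show ?thesis
      using assms(3,4) by (subst adjacent_hier_prod_iff) auto
  next
    \<comment> \<open>\<open>adjacent_hier_prod_iff\<close> covers only pairs of vertices; here both
      sides are false, as edges of a simple graph join only its vertices.\<close>
    case False
    have "verts (hier_prod G U H) = verts G \<times> verts H"
      by (simp add: hier_prod_def)
    then show ?thesis
      using False adjacent_in_verts[OF prod, of "(u, v)" "(x, y)"]
        adjacent_in_verts[OF G, of u x] adjacent_in_verts[OF H, of v y] assms(3,4)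
      by (auto split: if_splits)
  qed
  then have "{p. adjacent (hier_prod G U H) (u, v) p} = ?N \<union> ?M" by fast
  moreover have "finite ?N" "finite ?M" "?N \<inter> ?M = {}"
    using finite_neighbours[OF G] finite_neighbours[OF H] irrefl by auto
  ultimately show ?thesis
    by (simp add: degree_eq_card_neighbours[OF prod] degree_eq_card_neighbours[OF G]
        degree_eq_card_neighbours[OF H] card_Un_disjoint card_cartesian_product)
qed

theorem theorem1:
  fixes G :: "'a ugraph" and H :: "'b ugraph" and U :: "'a set"
  assumes "connected_graph G" and "card (verts G) \<ge> 2"
    and "connected_graph H"
    and "U \<noteq> {}" and "U \<subseteq> verts G"
  shows "F_index (hier_prod G U H) =
    card (verts H) * F_index G
    + 6 * card (edges H) * (\<Sum>u\<in>U. degree G u ^ 2)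
    + 3 * first_Zagreb H * (\<Sum>u\<in>U. degree G u)
    + card U * F_index H"
proof -
  have G: "simple_graph G" and H: "simple_graph H"
    using assms by (auto simp: connected_graph_def)
  have fin: "finite (verts G)" using G by (simp add: simple_graph_def)
  \<comment> \<open>The surplus of a fibre over u in U; the 6 is the binomial coefficient 3 times
    the 2 of the handshake lemma.\<close>
  let ?c = "\<lambda>u. 6 * card (edges H) * degree G u ^ 2 + 3 * first_Zagreb H * degree G u + F_index H"
  have fibre: "(\<Sum>v\<in>verts H. degree (hier_prod G U H) (u, v) ^ 3) =
      card (verts H) * degree G u ^ 3 + (if u \<in> U then ?c u else 0)"
    if u: "u \<in> verts G" for u
  proof (cases "u \<in> U")
    case True
    let ?d = "degree G u"
    have "(\<Sum>v\<in>verts H. degree (hier_prod G U H) (u, v) ^ 3) =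
        (\<Sum>v\<in>verts H. ?d ^ 3 + 3 * ?d ^ 2 * degree H v + 3 * ?d * degree H v ^ 2 + degree H v ^ 3)"
      using u True
      by (intro sum.cong)
        (auto simp: degree_hier_prod[OF G H] power2_eq_square power3_eq_cube algebra_simps)
    also have "\<dots> = card (verts H) * ?d ^ 3 + 3 * ?d ^ 2 * (\<Sum>v\<in>verts H. degree H v)
        + 3 * ?d * first_Zagreb H + F_index H"
      by (simp add: sum.distrib sum_distrib_left first_Zagreb_def F_index_def)
    finally show ?thesis
      using True by (simp add: sum_degree_eq_twice_card_edges[OF H] algebra_simps)
  next
    case False
    then show ?thesis
      using u by (simp add: degree_hier_prod[OF G H])
  qed
  have "F_index (hier_prod G U H) =
      (\<Sum>u\<in>verts G. \<Sum>v\<in>verts H. degree (hier_prod G U H) (u, v) ^ 3)"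
    by (simp add: F_index_def hier_prod_def sum.cartesian_product)
  also have "\<dots> = card (verts H) * F_index G + (\<Sum>u\<in>verts G. if u \<in> U then ?c u else 0)"
    by (simp add: fibre sum.distrib sum_distrib_left F_index_def)
  also have "(\<Sum>u\<in>verts G. if u \<in> U then ?c u else 0) = (\<Sum>u\<in>U. ?c u)"
    using fin assms(5) by (simp add: sum.inter_restrict[symmetric] Int_absorb1)
  finally show ?thesis
    by (simp add: sum.distrib sum_distrib_left)
qed

end
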